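(* Let $X$, $Y$ be topological spaces, $A\subset X$, $B\subset Y$. Let $(F,F')$ be a closed correspondence from $(X,A)$ to $(Y,B)$, let $(G,G')$ be a homologically consistent enlargement of $(F,F')$ (a closed, homologically consistent correspondence from $(X,A)$ to $(Y,B)$ with $F\subset G$ and $F'\subset G'$), and let $f\colon (X,A)\to(Y,B)$ be a continuous selector of $(G,G')$. If $(F,F')$ is homologically complete, then $f_*=(F,F')_*$, where $f_*\colon H_*(X,A)\to H_*(Y,B)$ is the homomorphism induced in homology by $f$ and $(F,F')_*$ is the homomorphism induced in homology by the correspondence $(F,F')$.
   Context: $H_*$ denotes a fixed homology theory on pairs of topological spaces (any choice is allowed, e.g. singular homology) with coefficients in a fixed arbitrary ring $R$. A correspondence from $(X,A)$ to $(Y,B)$ is a pair $(F,F')$ of relations with $F\subset X\times Y$, $F'\subset A\times B$ and $F'\subset F$ (relations are identified with their graphs, with the subspace topology from $X\times Y$). It is closed if both $F$ and $F'$ are closed subsets of $X\times Y$. A correspondence $(G,G')$ is an enlargement of $(F,F')$ if $F\subset G$ and $F'\subset G'$. A map $f\colon(X,A)\to(Y,B)$ (a function $f\colon X\to Y$ with $f(A)\subset B$) is regarded as the correspondence given by the graphs of $f$ and $f|_A$; it is a selector of $(G,G')$ if $(G,G')$ is an enlargement of it. For a closed correspondence $(F,F')$ let $p\colon (F,F')\to (X,A)$ and $q\colon (F,F')\to (Y,B)$ be the canonical projections. $(F,F')$ is homologically complete if $p_*\colon H_*(F,F')\to H_*(X,A)$ is an epimorphism, and homologically consistent if $\ker p_*\subset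 \ker q_*$. Induced homomorphism of a closed correspondence: let $\widetilde{p_*}\colon H_*(F,F')/\ker p_*\to \operatorname{im} p_*$ be the isomorphism induced by $p_*$, and let $\widetilde{q_*}\colon H_*(F,F')/\ker p_*\to H_*(Y,B)/q_*(\ker p_* )$ be the homomorphism induced by $q_*$. Then $$(F,F')_* := \widetilde{q_*}\circ \widetilde{p_*}^{-1}\colon \operatorname{im} p_*\to H_*(Y,B)/q_*(\ker p_* ).$$ When $q_*(\ker p_* )=0$, the quotient $H_*(Y,B)/q_*(\ker p_* )$ is identified with $H_*(Y,B)$. The asserted equality includes that $q_*(\ker p_* )=0$. *)

theory Defs
  imports "HOL-Analysis.Analysis" "HOL-Algebra.AbelCoset" "HOL-Algebra.Module"
begin

section \<open>Left modules over an arbitrary ring\<close>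

text \<open>
  The locale \<open>module\<close> of HOL-Algebra requires the ring to be commutative. As the coefficient ring
  is arbitrary here, the same axioms (on the same record type) are stated for a ring that need not
  be commutative.
\<close>

locale left_module = R?: ring R + M?: abelian_group M
  for R :: "('r, 's) ring_scheme" (structure) and M :: "('r, 'm) module" (structure) +
  assumes lsmult_closed:
      "\<lbrakk>a \<in> carrier R; x \<in> carrier M\<rbrakk> \<Longrightarrow> a \<odot>\<^bsub>M\<^esub> x \<in> carrier M"
    and lsmult_l_distr:
      "\<lbrakk>a \<in> carrier R; b \<in> carrier R; x \<in> carrier M\<rbrakk> \<Longrightarrow>
        (a \<oplus> b) \<odot>\<^bsub>M\<^esub> x = a \<odot>\<^bsub>M\<^esub> x \<oplus>\<^bsub>M\<^esub> b \<odot>\<^bsub>M\<^esub> x"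
    and lsmult_r_distr:
      "\<lbrakk>a \<in> carrier R; x \<in> carrier M; y \<in> carrier M\<rbrakk> \<Longrightarrow>
        a \<odot>\<^bsub>M\<^esub> (x \<oplus>\<^bsub>M\<^esub> y) = a \<odot>\<^bsub>M\<^esub> x \<oplus>\<^bsub>M\<^esub> a \<odot>\<^bsub>M\<^esub> y"
    and lsmult_assoc:
      "\<lbrakk>a \<in> carrier R; b \<in> carrier R; x \<in> carrier M\<rbrakk> \<Longrightarrow>
        (a \<otimes> b) \<odot>\<^bsub>M\<^esub> x = a \<odot>\<^bsub>M\<^esub> (b \<odot>\<^bsub>M\<^esub> x)"
    and lsmult_one:
      "x \<in> carrier M \<Longrightarrow> \<one> \<odot>\<^bsub>M\<^esub> x = x"

definition lmod_hom ::
  "('r, 's) ring_scheme \<Rightarrow> ('r, 'm) module \<Rightarrow> ('r, 'n) module \<Rightarrow> ('m \<Rightarrow> 'n) set" where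
  "lmod_hom R M N = {h. h \<in> carrier M \<rightarrow> carrier N \<and>
     (\<forall>x \<in> carrier M. \<forall>y \<in> carrier M. h (x \<oplus>\<^bsub>M\<^esub> y) = h x \<oplus>\<^bsub>N\<^esub> h y) \<and>
     (\<forall>a \<in> carrier R. \<forall>x \<in> carrier M. h (a \<odot>\<^bsub>M\<^esub> x) = a \<odot>\<^bsub>N\<^esub> h x)}"

definition regular_module :: "('r, 's) ring_scheme \<Rightarrow> ('r, 'r) module" where
  "regular_module R = \<lparr>carrier = carrier R, mult = mult R, one = one R,
     zero = zero R, add = add R, smult = mult R\<rparr>"


section \<open>Homology theories on pairs of topological spaces\<close>

definition pair_map ::
  "'u topology \<Rightarrow> 'u set \<Rightarrow> 'u topology \<Rightarrow> 'u set \<Rightarrow> ('u \<Rightarrow> 'u) \<Rightarrow> bool" where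
  "pair_map X A Y B f \<longleftrightarrow> continuous_map X Y f \<and> f ` A \<subseteq> B"

text \<open>
  A homology theory with coefficients in \<open>R\<close> in the sense of Eilenberg and Steenrod, on the pairs of
  topological spaces whose points are taken from an arbitrary type \<open>'u\<close> (which plays the role of a
  universe, since a type of all topological spaces does not exist in HOL):
  \<open>H k X A\<close> is the \<open>k\<close>-th homology module of \<open>(X, A)\<close>,
  \<open>ind k X A Y B f\<close> is the homomorphism from \<open>H k X A\<close> to \<open>H k Y B\<close> induced by \<open>f\<close>, and
  \<open>bd k X A\<close> is the boundary homomorphism from \<open>H k X A\<close> to \<open>H (k - 1) (subtopology X A) {}\<close>.
  All of these are only specified for \<open>A \<subseteq> topspace X\<close>, and the homomorphisms only on carriers.
  Since maps which agree on \<open>topspace X\<close> are homotopic, the homotopy axiom also says that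
  \<open>ind k X A Y B f\<close> depends on the restriction of \<open>f\<close> to \<open>topspace X\<close> only.
\<close>

locale homology_theory = R?: ring R
  for R :: "('r, 's) ring_scheme" (structure)
  and H :: "int \<Rightarrow> 'u topology \<Rightarrow> 'u set \<Rightarrow> ('r, 'm) module"
  and ind :: "int \<Rightarrow> 'u topology \<Rightarrow> 'u set \<Rightarrow> 'u topology \<Rightarrow> 'u set \<Rightarrow> ('u \<Rightarrow> 'u) \<Rightarrow> 'm \<Rightarrow> 'm"
  and bd :: "int \<Rightarrow> 'u topology \<Rightarrow> 'u set \<Rightarrow> 'm \<Rightarrow> 'm" +
  assumes homology_module:
      "A \<subseteq> topspace X \<Longrightarrow> left_module R (H k X A)"
    and ind_hom:
      "\<lbrakk>A \<subseteq> topspace X; B \<subseteq> topspace Y; pair_map X A Y B f\<rbrakk> \<Longrightarrow>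
        ind k X A Y B f \<in> lmod_hom R (H k X A) (H k Y B)"
    and bd_hom:
      "A \<subseteq> topspace X \<Longrightarrow> bd k X A \<in> lmod_hom R (H k X A) (H (k - 1) (subtopology X A) {})"
    and ind_id:
      "\<lbrakk>A \<subseteq> topspace X; x \<in> carrier (H k X A)\<rbrakk> \<Longrightarrow> ind k X A X A id x = x"
    and ind_compose:
      "\<lbrakk>A \<subseteq> topspace X; B \<subseteq> topspace Y; C \<subseteq> topspace Z;
        pair_map X A Y B f; pair_map Y B Z C g; x \<in> carrier (H k X A)\<rbrakk> \<Longrightarrow>
        ind k X A Z C (g \<circ> f) x = ind k Y B Z C g (ind k X A Y B f x)"
    and bd_natural:
      "\<lbrakk>A \<subseteq> topspace X; B \<subseteq> topspace Y; pair_map X A Y B f; x \<in> carrier (H k X A)\<rbrakk> \<Longrightarrow>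
        bd k Y B (ind k X A Y B f x) =
        ind (k - 1) (subtopology X A) {} (subtopology Y B) {} f (bd k X A x)"
    and exactness_absolute:
      "A \<subseteq> topspace X \<Longrightarrow>
        ind k (subtopology X A) {} X {} id ` carrier (H k (subtopology X A) {}) =
        a_kernel (H k X {}) (H k X A) (ind k X {} X A id)"
    and exactness_relative:
      "A \<subseteq> topspace X \<Longrightarrow>
        ind k X {} X A id ` carrier (H k X {}) =
        a_kernel (H k X A) (H (k - 1) (subtopology X A) {}) (bd k X A)"
    and exactness_boundary:
      "A \<subseteq> topspace X \<Longrightarrow>
        bd k X A ` carrier (H k X A) =
        a_kernel (H (k - 1) (subtopology X A) {}) (H (k - 1) X {})
          (ind (k - 1) (subtopology X A) {} X {} id)"
    and homotopy:
      "\<lbrakk>A \<subseteq> topspace X; B \<subseteq> topspace Y; homotopic_with (\<lambda>h. h ` A \<subseteq> B) X Y f g;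
        x \<in> carrier (H k X A)\<rbrakk> \<Longrightarrow>
        ind k X A Y B f x = ind k X A Y B g x"
    and excision:
      "\<lbrakk>A \<subseteq> topspace X; openin X U; X closure_of U \<subseteq> X interior_of A\<rbrakk> \<Longrightarrow>
        bij_betw (ind k (subtopology X (topspace X - U)) (A - U) X A id)
          (carrier (H k (subtopology X (topspace X - U)) (A - U))) (carrier (H k X A))"
    and dimension:
      "\<lbrakk>topspace X = {a}; k \<noteq> 0\<rbrakk> \<Longrightarrow> carrier (H k X {}) = {\<zero>\<^bsub>H k X {}\<^esub>}"
    and coefficients:
      "topspace X = {a} \<Longrightarrow>
        \<exists>h \<in> lmod_hom R (regular_module R) (H 0 X {}). bij_betw h (carrier R) (carrier (H 0 X {}))"


section \<open>Correspondences\<close>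

definition correspondence ::
  "'u topology \<Rightarrow> 'u set \<Rightarrow> 'u topology \<Rightarrow> 'u set \<Rightarrow> ('u \<times> 'u) set \<Rightarrow> ('u \<times> 'u) set \<Rightarrow> bool" where
  "correspondence X A Y B F F' \<longleftrightarrow>
     F \<subseteq> topspace X \<times> topspace Y \<and> F' \<subseteq> A \<times> B \<and> F' \<subseteq> F"

definition closed_correspondence ::
  "'u topology \<Rightarrow> 'u set \<Rightarrow> 'u topology \<Rightarrow> 'u set \<Rightarrow> ('u \<times> 'u) set \<Rightarrow> ('u \<times> 'u) set \<Rightarrow> bool" where
  "closed_correspondence X A Y B F F' \<longleftrightarrow>
     correspondence X A Y B F F' \<and>
     closedin (prod_topology X Y) F \<and> closedin (prod_topology X Y) F'"

definition enlargement ::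
  "('u \<times> 'u) set \<Rightarrow> ('u \<times> 'u) set \<Rightarrow> ('u \<times> 'u) set \<Rightarrow> ('u \<times> 'u) set \<Rightarrow> bool" where
  "enlargement G G' F F' \<longleftrightarrow> F \<subseteq> G \<and> F' \<subseteq> G'"

definition graph_on :: "'u set \<Rightarrow> ('u \<Rightarrow> 'u) \<Rightarrow> ('u \<times> 'u) set" where
  "graph_on S f = (\<lambda>x. (x, f x)) ` S"

definition selector ::
  "'u topology \<Rightarrow> 'u set \<Rightarrow> ('u \<times> 'u) set \<Rightarrow> ('u \<times> 'u) set \<Rightarrow> ('u \<Rightarrow> 'u) \<Rightarrow> bool" where
  "selector X A G G' f \<longleftrightarrow> enlargement G G' (graph_on (topspace X) f) (graph_on A f)"

text \<open>
  The points of a relation \<open>F\<close> are pairs, whereas the homology theory is about spaces with points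
  in \<open>'u\<close>. Therefore pairs are coded in \<open>'u\<close> by a function \<open>e\<close> that is injective on
  \<open>topspace X \<times> topspace Y\<close>: \<open>rel_space e X Y F\<close> is the copy under \<open>e\<close> of the relation \<open>F\<close> with its
  subspace topology, and \<open>proj1\<close>, \<open>proj2\<close> are the two projections of such a copy.
\<close>

definition rel_space ::
  "('u \<times> 'u \<Rightarrow> 'u) \<Rightarrow> 'u topology \<Rightarrow> 'u topology \<Rightarrow> ('u \<times> 'u) set \<Rightarrow> 'u topology" where
  "rel_space e X Y F =
     pullback_topology (e ` F) (inv_into (topspace X \<times> topspace Y) e) (prod_topology X Y)"

definition proj1 :: "('u \<times> 'u \<Rightarrow> 'u) \<Rightarrow> 'u topology \<Rightarrow> 'u topology \<Rightarrow> 'u \<Rightarrow> 'u" where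
  "proj1 e X Y = fst \<circ> inv_into (topspace X \<times> topspace Y) e"

definition proj2 :: "('u \<times> 'u \<Rightarrow> 'u) \<Rightarrow> 'u topology \<Rightarrow> 'u topology \<Rightarrow> 'u \<Rightarrow> 'u" where
  "proj2 e X Y = snd \<circ> inv_into (topspace X \<times> topspace Y) e"

lemma homeomorphic_map_rel_space:
  assumes inj: "inj_on e (topspace X \<times> topspace Y)" and F: "F \<subseteq> topspace X \<times> topspace Y"
  shows "homeomorphic_map (subtopology (prod_topology X Y) F) (rel_space e X Y F) e"
proof -
  let ?P = "topspace X \<times> topspace Y"
  let ?i = "inv_into ?P e"
  have i: "?i (e z) = z" if "z \<in> ?P" for z
    using inj that by simp
  have "continuous_map (subtopology (prod_topology X Y) F) (rel_space e X Y F) e"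
    unfolding rel_space_def
  proof (rule continuous_map_pullback')
    show "continuous_map (subtopology (prod_topology X Y) F) (prod_topology X Y) (?i \<circ> e)"
      by (rule continuous_map_eq[where f = id])
        (use F in \<open>auto simp: inj continuous_map_from_subtopology\<close>)
    show "topspace (subtopology (prod_topology X Y) F) \<subseteq> e -` e ` F"
      by auto
  qed
  moreover have "continuous_map (rel_space e X Y F) (subtopology (prod_topology X Y) F) ?i"
    unfolding rel_space_def continuous_map_in_subtopology
  proof
    show "continuous_map (pullback_topology (e ` F) ?i (prod_topology X Y)) (prod_topology X Y) ?i"
      using continuous_map_pullback[OF continuous_map_id, of "e ` F" ?i "prod_topology X Y"] by simp
    show "?i \<in> topspace (pullback_topology (e ` F) ?i (prod_topology X Y)) \<rightarrow> F"
      using F i by (auto simp: topspace_pullback_topology)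
  qed
  ultimately have
    "homeomorphic_maps (subtopology (prod_topology X Y) F) (rel_space e X Y F) e ?i"
    unfolding homeomorphic_maps_def
    using F i by (auto simp: rel_space_def topspace_pullback_topology)
  then show ?thesis
    by (rule homeomorphic_maps_imp_map)
qed


section \<open>The homomorphism induced in homology by a correspondence\<close>

text \<open>
  The graded module \<open>H\<^sub>*\<close> is the family of the modules \<open>H k\<close>, and homomorphisms of graded modules are
  families of homomorphisms, so that everything below is taken degree by degree.
\<close>

definition corr_homology where
  "corr_homology H e X Y F F' k = H k (rel_space e X Y F) (e ` F')"

definition proj1_ind where
  "proj1_ind ind e X A Y F F' k = ind k (rel_space e X Y F) (e ` F') X A (proj1 e X Y)"

definition proj2_ind where
  "proj2_ind ind e X Y B F F' k = ind k (rel_space e X Y F) (e ` F') Y B (proj2 e X Y)"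

definition ker_p where
  "ker_p H ind e X A Y F F' k =
     a_kernel (corr_homology H e X Y F F' k) (H k X A) (proj1_ind ind e X A Y F F' k)"

definition im_p where
  "im_p H ind e X A Y F F' k =
     proj1_ind ind e X A Y F F' k ` carrier (corr_homology H e X Y F F' k)"

definition ker_q where
  "ker_q H ind e X Y B F F' k =
     a_kernel (corr_homology H e X Y F F' k) (H k Y B) (proj2_ind ind e X Y B F F' k)"

definition q_ker_p where
  "q_ker_p H ind e X A Y B F F' k =
     proj2_ind ind e X Y B F F' k ` ker_p H ind e X A Y F F' k"

definition homologically_complete where
  "homologically_complete H ind e X A Y F F' \<longleftrightarrow>
     (\<forall>k. im_p H ind e X A Y F F' k = carrier (H k X A))"

definition homologically_consistent where
  "homologically_consistent H ind e X A Y B F F' \<longleftrightarrow>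
     (\<forall>k. ker_p H ind e X A Y F F' k \<subseteq> ker_q H ind e X Y B F F' k)"

text \<open>
  Elements of a quotient module are cosets. \<open>p_tilde\<close> sends a coset of \<open>ker p\<^sub>*\<close> to the only value that
  \<open>p\<^sub>*\<close> takes on it; \<open>q_tilde\<close> sends it to the only coset of \<open>q\<^sub>*(ker p\<^sub>*)\<close> met by the values of \<open>q\<^sub>*\<close> on it.
\<close>

definition p_tilde where
  "p_tilde ind e X A Y F F' k C = the_elem (proj1_ind ind e X A Y F F' k ` C)"

definition q_tilde where
  "q_tilde H ind e X A Y B F F' k C =
     the_elem ((\<lambda>z. q_ker_p H ind e X A Y B F F' k +>\<^bsub>H k Y B\<^esub> proj2_ind ind e X Y B F F' k z) ` C)"

definition corr_ind where
  "corr_ind H ind e X A Y B F F' k =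
     (\<lambda>x \<in> im_p H ind e X A Y F F' k.
        q_tilde H ind e X A Y B F F' k
          (inv_into (a_rcosets\<^bsub>corr_homology H e X Y F F' k\<^esub> (ker_p H ind e X A Y F F' k))
             (p_tilde ind e X A Y F F' k) x))"

end

theory Submission
  imports Defs
begin

text \<open>
  Since \<open>f\<close> is a selector of \<open>(G, G')\<close>, the map \<open>s x = (x, f x)\<close> is a section over \<open>(X, A)\<close> of the
  projection \<open>p\<^sub>G\<close> of \<open>(G, G')\<close> onto \<open>(X, A)\<close>, and \<open>q\<^sub>G \<circ> s = f\<close>. Let \<open>i\<close> be the inclusion of
  \<open>(F, F')\<close> in \<open>(G, G')\<close>. For a homology class \<open>z\<close> of \<open>(F, F')\<close> the two classes \<open>i\<^sub>* z\<close> and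
  \<open>s\<^sub>* (p\<^sub>* z)\<close> of \<open>(G, G')\<close> have the same image \<open>p\<^sub>* z\<close> under \<open>p\<^sub>G\<^sub>*\<close>, so their difference lies in
  \<open>ker p\<^sub>G\<^sub>*\<close>. By consistency it lies in \<open>ker q\<^sub>G\<^sub>*\<close> too, and this says that
  \<open>q\<^sub>* z = f\<^sub>* (p\<^sub>* z)\<close> (lemma \<open>proj2_ind_eq_ind_proj1_ind\<close>).

  From \<open>q\<^sub>* = f\<^sub>* \<circ> p\<^sub>*\<close> the rest is algebra: \<open>q\<^sub>*\<close> vanishes on \<open>ker p\<^sub>*\<close>, and the homomorphism
  induced by the correspondence, which sends \<open>p\<^sub>* z\<close> to the class of \<open>q\<^sub>* z\<close>, is \<open>f\<^sub>*\<close> on the image of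
  \<open>p\<^sub>*\<close>. By completeness that image is all of \<open>H\<^sub>*(X, A)\<close>.
\<close>

section \<open>Homomorphisms on cosets of their kernels\<close>

lemma lmod_hom_abelian_group_hom:
  assumes "left_module R M" and "left_module R N" and "h \<in> lmod_hom R M N"
  shows "abelian_group_hom M N h"
proof -
  interpret M: left_module R M by fact
  interpret N: left_module R N by fact
  show ?thesis
    by (rule abelian_group_homI)
      (use assms(3) M.abelian_group_axioms N.abelian_group_axioms in
        \<open>auto simp: lmod_hom_def group_hom_def group_hom_axioms_def hom_def\<close>)
qed

text \<open>
  The definition of the homomorphism induced by a correspondence evaluates maps on cosets by taking
  the only element of an image; for \<open>p_tilde\<close> that element is determined here.
\<close>

lemma (in abelian_group_hom) image_kernel_coset:
  assumes "z \<in> carrier G"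
  shows "h ` (a_kernel G H h +> z) = {h z}"
proof -
  have "h (k \<oplus> z) = h z" if "k \<in> a_kernel G H h" for k
    using that assms by (simp add: a_kernel_def')
  moreover have "a_kernel G H h \<noteq> {}"
    using zero_closed hom_zero by (auto simp: a_kernel_def')
  moreover have "h ` (a_kernel G H h +> z) = (\<lambda>k. h (k \<oplus> z)) ` a_kernel G H h"
    by (auto simp: a_r_coset_def')
  ultimately show ?thesis
    by auto
qed

section \<open>The projections of a correspondence and the section given by a selector\<close>

lemma topspace_rel_space:
  assumes "inj_on e (topspace X \<times> topspace Y)" and "F \<subseteq> topspace X \<times> topspace Y"
  shows "topspace (rel_space e X Y F) = e ` F"
  using assms by (auto simp: rel_space_def topspace_pullback_topology)

lemma continuous_map_rel_space_inv:
  "continuous_map (rel_space e X Y F) (prod_topology X Y) (inv_into (topspace X \<times> topspace Y) e)"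
  using continuous_map_pullback[OF continuous_map_id, of "e ` F" _ "prod_topology X Y"]
  by (simp add: rel_space_def)

context
  fixes e :: "'u \<times> 'u \<Rightarrow> 'u" and X Y :: "'u topology"
  assumes inj: "inj_on e (topspace X \<times> topspace Y)"
begin

lemma proj1_code [simp]: "z \<in> topspace X \<times> topspace Y \<Longrightarrow> proj1 e X Y (e z) = fst z"
  using inj by (simp add: proj1_def)

lemma proj2_code [simp]: "z \<in> topspace X \<times> topspace Y \<Longrightarrow> proj2 e X Y (e z) = snd z"
  using inj by (simp add: proj2_def)

lemma correspondence_code_subset:
  assumes "correspondence X A Y B F F'"
  shows "e ` F' \<subseteq> topspace (rel_space e X Y F)"
  using assms inj by (auto simp: correspondence_def topspace_rel_space)

lemma pair_map_proj1:
  assumes "correspondence X A Y B F F'"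
  shows "pair_map (rel_space e X Y F) (e ` F') X A (proj1 e X Y)"
  unfolding pair_map_def
proof
  show "continuous_map (rel_space e X Y F) X (proj1 e X Y)"
    unfolding proj1_def
    by (rule continuous_map_compose[OF continuous_map_rel_space_inv continuous_map_fst])
  have "F' \<subseteq> topspace X \<times> topspace Y"
    using assms by (auto simp: correspondence_def)
  then show "proj1 e X Y ` e ` F' \<subseteq> A"
    using assms by (fastforce simp: correspondence_def)
qed

lemma pair_map_proj2:
  assumes "correspondence X A Y B F F'"
  shows "pair_map (rel_space e X Y F) (e ` F') Y B (proj2 e X Y)"
  unfolding pair_map_def
proof
  show "continuous_map (rel_space e X Y F) Y (proj2 e X Y)"
    unfolding proj2_def
    by (rule continuous_map_compose[OF continuous_map_rel_space_inv continuous_map_snd])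
  have "F' \<subseteq> topspace X \<times> topspace Y"
    using assms by (auto simp: correspondence_def)
  then show "proj2 e X Y ` e ` F' \<subseteq> B"
    using assms by (fastforce simp: correspondence_def)
qed

lemma pair_map_inclusion:
  assumes "correspondence X A Y B F F'" and "enlargement G G' F F'"
  shows "pair_map (rel_space e X Y F) (e ` F') (rel_space e X Y G) (e ` G') id"
  unfolding pair_map_def
proof
  have "continuous_map (rel_space e X Y F)
      (pullback_topology (e ` G) (inv_into (topspace X \<times> topspace Y) e) (prod_topology X Y)) id"
  proof (rule continuous_map_pullback')
    show "continuous_map (rel_space e X Y F) (prod_topology X Y)
        (inv_into (topspace X \<times> topspace Y) e \<circ> id)"
      by (simp add: continuous_map_rel_space_inv)
    show "topspace (rel_space e X Y F) \<subseteq> id -` e ` G"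
      using assms inj by (auto simp: correspondence_def enlargement_def topspace_rel_space)
  qed
  then show "continuous_map (rel_space e X Y F) (rel_space e X Y G) id"
    unfolding rel_space_def .
  show "id ` e ` F' \<subseteq> e ` G'"
    using assms by (auto simp: enlargement_def)
qed

lemma pair_map_section:
  assumes "correspondence X A Y B G G'" and "selector X A G G' f" and "continuous_map X Y f"
  shows "pair_map X A (rel_space e X Y G) (e ` G') (\<lambda>x. e (x, f x))"
  unfolding pair_map_def
proof
  have "continuous_map X (subtopology (prod_topology X Y) G) (\<lambda>x. (x, f x))"
    using assms
    by (auto simp: selector_def enlargement_def graph_on_def continuous_map_in_subtopology
        continuous_map_pairwise comp_def)
  moreover have "continuous_map (subtopology (prod_topology X Y) G) (rel_space e X Y G) e"
    using assms homeomorphic_map_rel_space[OF inj]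
    by (auto simp: correspondence_def intro: homeomorphic_imp_continuous_map)
  ultimately have "continuous_map X (rel_space e X Y G) (e \<circ> (\<lambda>x. (x, f x)))"
    by (rule continuous_map_compose)
  then show "continuous_map X (rel_space e X Y G) (\<lambda>x. e (x, f x))"
    by (simp add: comp_def)
  show "(\<lambda>x. e (x, f x)) ` A \<subseteq> e ` G'"
    using assms by (auto simp: selector_def enlargement_def graph_on_def)
qed

end

section \<open>Homology classes of a correspondence and of a selector\<close>

context homology_theory
begin

lemma ind_abelian_group_hom:
  assumes "A \<subseteq> topspace X" and "B \<subseteq> topspace Y" and "pair_map X A Y B f"
  shows "abelian_group_hom (H k X A) (H k Y B) (ind k X A Y B f)"
  using lmod_hom_abelian_group_hom[OF homology_module homology_module ind_hom] assms by blast

text \<open>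
  The identities \<open>p\<^sub>G \<circ> s = id\<close> and \<open>q\<^sub>G \<circ> s = f\<close> hold only at the points of \<open>X\<close>; the constant homotopy
  makes this sufficient in homology.
\<close>

lemma ind_cong:
  assumes "A \<subseteq> topspace X" and "B \<subseteq> topspace Y" and "pair_map X A Y B f"
    and eq: "\<And>x. x \<in> topspace X \<Longrightarrow> f x = g x"
    and "x \<in> carrier (H k X A)"
  shows "ind k X A Y B f x = ind k X A Y B g x"
proof (rule homotopy)
  have "f ` A = g ` A"
    using assms(1) eq by (auto simp: image_def subset_iff)
  then show "homotopic_with (\<lambda>h. h ` A \<subseteq> B) X Y f g"
    using assms by (intro homotopic_with_equal) (auto simp: pair_map_def)
qed (use assms in auto)

context
  fixes e :: "'u \<times> 'u \<Rightarrow> 'u" and X Y :: "'u topology" and A B :: "'u set"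
  assumes inj: "inj_on e (topspace X \<times> topspace Y)"
    and A: "A \<subseteq> topspace X" and B: "B \<subseteq> topspace Y"
begin

lemma proj1_ind_abelian_group_hom:
  assumes "correspondence X A Y B F F'"
  shows "abelian_group_hom (corr_homology H e X Y F F' k) (H k X A) (proj1_ind ind e X A Y F F' k)"
  unfolding corr_homology_def proj1_ind_def
  using correspondence_code_subset[OF inj assms] A pair_map_proj1[OF inj assms]
  by (rule ind_abelian_group_hom)

lemma proj2_ind_abelian_group_hom:
  assumes "correspondence X A Y B F F'"
  shows "abelian_group_hom (corr_homology H e X Y F F' k) (H k Y B) (proj2_ind ind e X Y B F F' k)"
  unfolding corr_homology_def proj2_ind_def
  using correspondence_code_subset[OF inj assms] B pair_map_proj2[OF inj assms]
  by (rule ind_abelian_group_hom)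

text \<open>
  Consistency of \<open>(G, G')\<close> is applied to the difference of
  the classes \<open>i\<^sub>* z\<close> and \<open>s\<^sub>* (p\<^sub>* z)\<close>.
\<close>

lemma proj2_ind_eq_ind_proj1_ind:
  assumes F: "correspondence X A Y B F F'" and G: "correspondence X A Y B G G'"
    and enl: "enlargement G G' F F'"
    and cons: "homologically_consistent H ind e X A Y B G G'"
    and f: "pair_map X A Y B f" and sel: "selector X A G G' f"
    and z: "z \<in> carrier (corr_homology H e X Y F F' k)"
  shows "proj2_ind ind e X Y B F F' k z = ind k X A Y B f (proj1_ind ind e X A Y F F' k z)"
proof -
  let ?F = "rel_space e X Y F" and ?G = "rel_space e X Y G"
  let ?s = "\<lambda>x. e (x, f x)"
  let ?p = "proj1 e X Y" and ?q = "proj2 e X Y"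
  let ?pG = "proj1_ind ind e X A Y G G' k" and ?qG = "proj2_ind ind e X Y B G G' k"
  let ?i' = "ind k ?F (e ` F') ?G (e ` G') id"
  let ?s' = "ind k X A ?G (e ` G') ?s"
  have cf: "continuous_map X Y f" and fX: "\<And>x. x \<in> topspace X \<Longrightarrow> f x \<in> topspace Y"
    using f by (auto simp: pair_map_def continuous_map_def)
  note sub_F = correspondence_code_subset[OF inj F] and sub_G = correspondence_code_subset[OF inj G]
  note maps = pair_map_inclusion[OF inj F enl] pair_map_section[OF inj G sel cf]
    pair_map_proj1[OF inj F] pair_map_proj1[OF inj G] pair_map_proj2[OF inj G]
  interpret i: abelian_group_hom "corr_homology H e X Y F F' k" "corr_homology H e X Y G G' k" ?i'
    unfolding corr_homology_def by (rule ind_abelian_group_hom[OF sub_F sub_G maps(1)])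
  interpret s: abelian_group_hom "H k X A" "corr_homology H e X Y G G' k" ?s'
    unfolding corr_homology_def by (rule ind_abelian_group_hom[OF A sub_G maps(2)])
  interpret pF: abelian_group_hom "corr_homology H e X Y F F' k" "H k X A"
    "proj1_ind ind e X A Y F F' k"
    by (rule proj1_ind_abelian_group_hom[OF F])
  interpret pG: abelian_group_hom "corr_homology H e X Y G G' k" "H k X A" ?pG
    by (rule proj1_ind_abelian_group_hom[OF G])
  interpret qG: abelian_group_hom "corr_homology H e X Y G G' k" "H k Y B" ?qG
    by (rule proj2_ind_abelian_group_hom[OF G])
  have z': "z \<in> carrier (H k ?F (e ` F'))"
    using z by (simp add: corr_homology_def)
  have p_i: "?pG (?i' z) = proj1_ind ind e X A Y F F' k z"
    using ind_compose[OF sub_F sub_G A maps(1) maps(4) z'] by (simp add: proj1_ind_def)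
  have q_i: "?qG (?i' z) = proj2_ind ind e X Y B F F' k z"
    using ind_compose[OF sub_F sub_G B maps(1) maps(5) z'] by (simp add: proj2_ind_def)
  have p_s: "?pG (?s' x) = x" if x: "x \<in> carrier (H k X A)" for x
  proof -
    have "?pG (?s' x) = ind k X A X A (?p \<circ> ?s) x"
      using ind_compose[OF A sub_G A maps(2) maps(4) x] by (simp add: proj1_ind_def)
    also have "\<dots> = ind k X A X A id x"
      by (rule ind_cong[OF A A _ _ x, symmetric])
        (use inj fX in \<open>auto simp: pair_map_def\<close>)
    finally show ?thesis
      using ind_id[OF A x] by simp
  qed
  have q_s: "?qG (?s' x) = ind k X A Y B f x" if x: "x \<in> carrier (H k X A)" for x
  proof -
    have "?qG (?s' x) = ind k X A Y B (?q \<circ> ?s) x"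
      using ind_compose[OF A sub_G B maps(2) maps(5) x] by (simp add: proj2_ind_def)
    also have "\<dots> = ind k X A Y B f x"
      by (rule ind_cong[OF A B f _ x, symmetric]) (use inj fX in auto)
    finally show ?thesis .
  qed
  define x where "x = proj1_ind ind e X A Y F F' k z"
  have x: "x \<in> carrier (H k X A)"
    unfolding x_def using z by (rule pF.hom_closed)
  define w where "w = ?i' z \<ominus>\<^bsub>corr_homology H e X Y G G' k\<^esub> ?s' x"
  have w: "w \<in> carrier (corr_homology H e X Y G G' k)"
    using z x by (simp add: w_def)
  have "?pG w = \<zero>\<^bsub>H k X A\<^esub>"
    using z x p_i p_s[OF x]
    by (simp add: w_def a_minus_def x_def[symmetric] s.G.r_neg)
  then have "?qG w = \<zero>\<^bsub>H k Y B\<^esub>"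
    using w cons
    by (auto simp: homologically_consistent_def ker_p_def ker_q_def a_kernel_def')
  then have "?qG (?i' z) \<ominus>\<^bsub>H k Y B\<^esub> ?qG (?s' x) = \<zero>\<^bsub>H k Y B\<^esub>"
    using z x by (simp add: w_def a_minus_def)
  then have "?qG (?i' z) = ?qG (?s' x)"
    using z x qG.H.minus_equality[of "?qG (?i' z)" "\<ominus>\<^bsub>H k Y B\<^esub> ?qG (?s' x)"]
    by (simp add: a_minus_def)
  then show ?thesis
    using q_i q_s[OF x] by (simp add: x_def)
qed

lemma q_ker_p_eq_zero:
  assumes F: "correspondence X A Y B F F'"
    and f: "pair_map X A Y B f"
    and factor: "\<And>z. z \<in> carrier (corr_homology H e X Y F F' k) \<Longrightarrow>
      proj2_ind ind e X Y B F F' k z = ind k X A Y B f (proj1_ind ind e X A Y F F' k z)"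
  shows "q_ker_p H ind e X A Y B F F' k = {\<zero>\<^bsub>H k Y B\<^esub>}"
proof -
  interpret p: abelian_group_hom "corr_homology H e X Y F F' k" "H k X A"
    "proj1_ind ind e X A Y F F' k"
    by (rule proj1_ind_abelian_group_hom[OF F])
  interpret f: abelian_group_hom "H k X A" "H k Y B" "ind k X A Y B f"
    by (rule ind_abelian_group_hom[OF A B f])
  have "\<zero>\<^bsub>corr_homology H e X Y F F' k\<^esub> \<in> ker_p H ind e X A Y F F' k"
    by (simp add: ker_p_def a_kernel_def')
  moreover have "proj2_ind ind e X Y B F F' k z = \<zero>\<^bsub>H k Y B\<^esub>"
    if "z \<in> ker_p H ind e X A Y F F' k" for z
    using that by (simp add: ker_p_def a_kernel_def' factor)
  ultimately show ?thesis
    by (force simp: q_ker_p_def)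
qed

text \<open>
  Whichever coset \<open>C\<close> of \<open>ker p\<^sub>*\<close> is chosen over \<open>x\<close>, the map \<open>p\<^sub>*\<close> is constant with value \<open>x\<close> on it,
  so that \<open>q\<^sub>* = f\<^sub>* \<circ> p\<^sub>*\<close> is constant with value \<open>f\<^sub>* x\<close> on it. So the value does not
  depend on the choice that \<open>inv_into\<close> makes.
\<close>

lemma corr_ind_eq_ind:
  assumes F: "correspondence X A Y B F F'"
    and f: "pair_map X A Y B f"
    and factor: "\<And>z. z \<in> carrier (corr_homology H e X Y F F' k) \<Longrightarrow>
      proj2_ind ind e X Y B F F' k z = ind k X A Y B f (proj1_ind ind e X A Y F F' k z)"
    and x: "x \<in> im_p H ind e X A Y F F' k"
  shows "corr_ind H ind e X A Y B F F' k x = {\<zero>\<^bsub>H k Y B\<^esub>} +>\<^bsub>H k Y B\<^esub> ind k X A Y B f x"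
proof -
  let ?Z = "corr_homology H e X Y F F' k"
  let ?p = "proj1_ind ind e X A Y F F' k" and ?q = "proj2_ind ind e X Y B F F' k"
  let ?K = "ker_p H ind e X A Y F F' k"
  let ?cosets = "a_rcosets\<^bsub>?Z\<^esub> ?K"
  interpret p: abelian_group_hom ?Z "H k X A" ?p
    by (rule proj1_ind_abelian_group_hom[OF F])
  have p_coset: "?p ` (?K +>\<^bsub>?Z\<^esub> z) = {?p z}" if "z \<in> carrier ?Z" for z
    unfolding ker_p_def using that by (rule p.image_kernel_coset)
  have "x \<in> p_tilde ind e X A Y F F' k ` ?cosets"
    using x by (force simp: im_p_def p_tilde_def p_coset A_RCOSETS_def')
  define C where "C = inv_into ?cosets (p_tilde ind e X A Y F F' k) x"
  have "C \<in> ?cosets" and C_x: "p_tilde ind e X A Y F F' k C = x"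
    unfolding C_def using \<open>x \<in> _ ` ?cosets\<close> by (auto intro: inv_into_into f_inv_into_f)
  then obtain z where z: "z \<in> carrier ?Z" and C_z: "C = ?K +>\<^bsub>?Z\<^esub> z"
    by (auto simp: A_RCOSETS_def')
  have pC: "?p ` C = {x}"
    using C_x by (simp add: p_tilde_def C_z p_coset[OF z])
  have "C \<subseteq> carrier ?Z"
    using z by (auto simp: C_z ker_p_def a_kernel_def' a_r_coset_def')
  then have "?q c = ind k X A Y B f x" if "c \<in> C" for c
    using that factor[of c] pC by (metis imageI singletonD subsetD)
  moreover have "C \<noteq> {}"
    using pC by auto
  ultimately have "(\<lambda>c. q_ker_p H ind e X A Y B F F' k +>\<^bsub>H k Y B\<^esub> ?q c) ` C
      = {{\<zero>\<^bsub>H k Y B\<^esub>} +>\<^bsub>H k Y B\<^esub> ind k X A Y B f x}"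
    using q_ker_p_eq_zero[OF F f factor] by auto
  then show ?thesis
    using x by (simp add: corr_ind_def q_tilde_def C_def)
qed

end

end

theorem theorem4p6:
  fixes R :: "('r, 's) ring_scheme"
    and H :: "int \<Rightarrow> 'u topology \<Rightarrow> 'u set \<Rightarrow> ('r, 'm) module"
    and ind :: "int \<Rightarrow> 'u topology \<Rightarrow> 'u set \<Rightarrow> 'u topology \<Rightarrow> 'u set \<Rightarrow> ('u \<Rightarrow> 'u) \<Rightarrow> 'm \<Rightarrow> 'm"
    and bd :: "int \<Rightarrow> 'u topology \<Rightarrow> 'u set \<Rightarrow> 'm \<Rightarrow> 'm"
    and X Y :: "'u topology" and A B :: "'u set"
    and e :: "'u \<times> 'u \<Rightarrow> 'u"
    and F F' G G' :: "('u \<times> 'u) set"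
    and f :: "'u \<Rightarrow> 'u"
  assumes "homology_theory R H ind bd"
    and "inj_on e (topspace X \<times> topspace Y)"
    and "A \<subseteq> topspace X" and "B \<subseteq> topspace Y"
    and "closed_correspondence X A Y B F F'"
    and "closed_correspondence X A Y B G G'"
    and "enlargement G G' F F'"
    and "homologically_consistent H ind e X A Y B G G'"
    and "pair_map X A Y B f"
    and "selector X A G G' f"
    and "homologically_complete H ind e X A Y F F'"
  shows "\<forall>k. im_p H ind e X A Y F F' k = carrier (H k X A) \<and>
             q_ker_p H ind e X A Y B F F' k = {\<zero>\<^bsub>H k Y B\<^esub>} \<and>
             (\<forall>x \<in> carrier (H k X A).
                corr_ind H ind e X A Y B F F' k x = {\<zero>\<^bsub>H k Y B\<^esub>} +>\<^bsub>H k Y B\<^esub> ind k X A Y B f x)"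
proof
  fix k
  interpret homology_theory R H ind bd by fact
  have F: "correspondence X A Y B F F'" and G: "correspondence X A Y B G G'"
    using assms by (auto simp: closed_correspondence_def)
  note factor = proj2_ind_eq_ind_proj1_ind[OF assms(2-4) F G assms(7-10)]
  have im: "im_p H ind e X A Y F F' k = carrier (H k X A)"
    using assms(11) by (simp add: homologically_complete_def)
  show "im_p H ind e X A Y F F' k = carrier (H k X A) \<and>
      q_ker_p H ind e X A Y B F F' k = {\<zero>\<^bsub>H k Y B\<^esub>} \<and>
      (\<forall>x \<in> carrier (H k X A).
        corr_ind H ind e X A Y B F F' k x = {\<zero>\<^bsub>H k Y B\<^esub>} +>\<^bsub>H k Y B\<^esub> ind k X A Y B f x)"
    using im q_ker_p_eq_zero[OF assms(2-4) F assms(9) factor]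
      corr_ind_eq_ind[OF assms(2-4) F assms(9) factor] by auto
qed

end
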